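(* Let $n=2$, $\xi_0=0$, $\xi_1=1$, i.e. let $\hat I[f]=h\,q(f(a),f(a+h))$ be a two-point (in general non-linear) quadrature formula for $I[f]=\int_a^{a+h}f(x)\,dx$ with $q:\mathbb{R}^2\to\mathbb{R}$, and let $\hat I$ be affinely exact on some function $f^*$. Then: (1) If $f^*\in C^3(\mathbb{R})$ with $f^*(x)\neq 0$ and $f^{*\prime}(x)\neq 0$ for all $x\in\mathbb{R}$, we have for $f\in C^3(\mathbb{R})$ $$|\hat I[f]-I[f]|\le \frac{h^3}{6}\sup_{\xi\in[a,a+h]}|N[f](\xi)|,$$ where $$\begin{aligned}N[f](\xi)=\;&f''(\xi)\bigl[1-3q^{(0,1)}(f(a),f(\xi))\bigr]-3f'(\xi)^2q^{(0,2)}(f(a),f(\xi))\\&-(\xi-a)\bigl[f^{(3)}(\xi)q^{(0,1)}(f(a),f(\xi))+3f'(\xi)f''(\xi)q^{(0,2)}(f(a),f(\xi))+f'(\xi)^3q^{(0,3)}(f(a),f(\xi))\bigr]\end{aligned}$$ is a nonlinear function of $f$ satisfying $N[f^*_{\alpha,\beta}]=0$ for all $\alpha,\beta\in\mathbb{R}$. (2) If $f^*\in C^2(\mathbb{R}\to R)$, $R\subseteq\mathbb{R}$, is bijective (from $\mathbb{R}$ onto $R$) with inverse function $f^{*(-1)}$, we have for $f\in C^2(\mathbb{R}\to R)$ $$|\hat I[f]-I[f]|\le\frac{h^3}{12}\sup_{\xi\in[a,a+h]}\left|f''(\xi)-\alpha_f^2\,f^{*\prime\prime}(\alpha_f\xi+\beta_f)\right|,$$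 where $$\alpha_f=\frac{f^{*(-1)}(f(a+h))-f^{*(-1)}(f(a))}{h},\qquad \beta_f=\frac{(a+h)f^{*(-1)}(f(a))-a\,f^{*(-1)}(f(a+h))}{h}.$$ (3) If $f^*\in C^2(\mathbb{R}\to R)$, $R\subseteq\mathbb{R}$, is bijective (from $\mathbb{R}$ onto $R$) with inverse function $f^{*(-1)}$ and satisfies $Lf^*=0$, where $(Lu)(x)=-(p(x)u'(x))'+s(x)u(x)$ for $p(x),s(x)>0$ on $[a,a+h]$, we have for $f\in C^2(\mathbb{R}\to R)$, with $\alpha_f,\beta_f$ given by the formulas in (2), $$|\hat I[f]-I[f]|\le C_f\sup_{\xi\in[a,a+h]}\left|(L_{\alpha_f,\beta_f}f)(\xi)\right|,$$ where $$(L_{\alpha,\beta}u)(x)=-\bigl(p(\alpha x+\beta)u'(x)\bigr)'+\alpha^2 s(\alpha x+\beta)u(x)$$ and $C_f=\int_a^{a+h}\int_a^{a+h}|G_f(x,y)|\,dx\,dy$, with $G_f(x,y)$ being the Green function of $L_{\alpha_f,\beta_f}$ subject to Dirichlet boundary conditions on $[a,a+h]$.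
   Context: It is assumed throughout that $q$ and $f$ are sufficiently smooth. $q^{(i,j)}$ denotes the partial derivative of $q$ of order $i$ in its first and order $j$ in its second argument. Where $q(c,c)$ is ill-defined, it is understood as $\lim_{y\to c}q(c,y)$. The formula $\hat I$ is affinely exact on $f^*$ if, with $f^*_{\alpha,\beta}(x)=f^*(\alpha x+\beta)$, one has $\hat I[f^*_{\alpha,\beta}]=I[f^*_{\alpha,\beta}]$ for all $\alpha,\beta\in\mathbb{R}$ and all $h>0$. $C^k(\mathbb{R}\to R)$ denotes the $C^k$ functions on $\mathbb{R}$ with values in $R$. The Green function $G$ of a linear second-order differential operator $D$ on $[a,a+h]$ with Dirichlet boundary conditions is the kernel such that $u(x)=\int_a^{a+h}G(x,y)g(y)\,dy$ solves $Du=g$ with $u(a)=u(a+h)=0$.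
   Formalization: In (1), f must have f(a) in the range of f*, and q is assumed C^3 in its second argument only near the values used: a q that is C^1 on the whole plane would contradict the hypotheses, and for f(a) outside the range of f* the bound can fail. *)

theory Defs
  imports "HOL-Analysis.Analysis"
begin

text \<open>\<open>C_on k g S\<close>: \<open>g\<close> is \<open>k\<close> times continuously differentiable on an open neighbourhood
  of \<open>S\<close> (hence on \<open>S\<close> itself if \<open>S\<close> is open).\<close>

definition C_on :: "nat \<Rightarrow> (real \<Rightarrow> real) \<Rightarrow> real set \<Rightarrow> bool" where
  "C_on k g S \<longleftrightarrow> (\<exists>T. open T \<and> S \<subseteq> T \<and>
     (\<forall>i<k. \<forall>x\<in>T. ((deriv ^^ i) g has_real_derivative (deriv ^^ Suc i) g x) (at x)) \<and>
     continuous_on T ((deriv ^^ k) g))"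

text \<open>\<open>pd i j q\<close> is the partial derivative \<open>q\<^sup>(\<^sup>i\<^sup>,\<^sup>j\<^sup>)\<close>.\<close>

definition pd :: "nat \<Rightarrow> nat \<Rightarrow> (real \<Rightarrow> real \<Rightarrow> real) \<Rightarrow> real \<Rightarrow> real \<Rightarrow> real" where
  "pd i j q x y = (deriv ^^ i) (\<lambda>s. (deriv ^^ j) (q s) y) x"

definition affine_comp :: "(real \<Rightarrow> real) \<Rightarrow> real \<Rightarrow> real \<Rightarrow> real \<Rightarrow> real" where
  "affine_comp fs \<alpha> \<beta> = (\<lambda>x. fs (\<alpha> * x + \<beta>))"

definition exact_int :: "real \<Rightarrow> real \<Rightarrow> (real \<Rightarrow> real) \<Rightarrow> real" where
  "exact_int a h f = integral {a..a + h} f"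

text \<open>The function \<open>q\<close> is total; its values \<open>q c c\<close> on the diagonal are those obtained after any
  extension by the limit of \<open>q c y\<close> for \<open>y\<close> tending to \<open>c\<close>.\<close>

definition quad :: "(real \<Rightarrow> real \<Rightarrow> real) \<Rightarrow> real \<Rightarrow> real \<Rightarrow> (real \<Rightarrow> real) \<Rightarrow> real" where
  "quad q a h f = h * q (f a) (f (a + h))"

definition affinely_exact :: "(real \<Rightarrow> real \<Rightarrow> real) \<Rightarrow> real \<Rightarrow> (real \<Rightarrow> real) \<Rightarrow> bool" where
  "affinely_exact q a fs \<longleftrightarrow>
     (\<forall>\<alpha> \<beta> h. h > 0 \<longrightarrow>
        quad q a h (affine_comp fs \<alpha> \<beta>) = exact_int a h (affine_comp fs \<alpha> \<beta>))"

definition err_op ::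
  "(real \<Rightarrow> real \<Rightarrow> real) \<Rightarrow> real \<Rightarrow> (real \<Rightarrow> real) \<Rightarrow> real \<Rightarrow> real" where
  "err_op q a f \<xi> =
     (deriv ^^ 2) f \<xi> * (1 - 3 * pd 0 1 q (f a) (f \<xi>))
     - 3 * (deriv f \<xi>)\<^sup>2 * pd 0 2 q (f a) (f \<xi>)
     - (\<xi> - a) * ((deriv ^^ 3) f \<xi> * pd 0 1 q (f a) (f \<xi>)
                  + 3 * deriv f \<xi> * (deriv ^^ 2) f \<xi> * pd 0 2 q (f a) (f \<xi>)
                  + (deriv f \<xi>) ^ 3 * pd 0 3 q (f a) (f \<xi>))"

text \<open>The \<open>C\<^sup>3\<close> functions \<open>f\<close> for which \<open>q\<close> is smooth (in its second argument) at the points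
  \<open>(f a, f \<xi>)\<close> where it is evaluated, and whose value at \<open>a\<close> lies in the range of \<open>fs\<close>. The range
  condition is needed because affine exactness on \<open>fs\<close> determines \<open>q\<close> only on
  \<open>range fs \<times> range fs\<close>. Smoothness of \<open>q\<close> on the whole plane cannot be required instead.
  Suppose \<open>fs\<close> is \<open>C\<^sup>1\<close> with nowhere vanishing derivative and \<open>m = Inf (range fs)\<close> is finite.
  Letting \<open>c\<close> tend to \<open>m\<close> in affine exactness gives \<open>q m y = m\<close> for \<open>y > m\<close> in the range,
  while \<open>pd 0 1 q c c = 1/2\<close> for \<open>c\<close> in the range, so \<open>q\<close> cannot be \<open>C\<^sup>1\<close> on the plane
  (similarly for a finite supremum). A nowhere zero such \<open>fs\<close> is always bounded on one side.\<close>

definition admissible ::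
  "(real \<Rightarrow> real \<Rightarrow> real) \<Rightarrow> (real \<Rightarrow> real) \<Rightarrow> real \<Rightarrow> real \<Rightarrow> (real \<Rightarrow> real) set" where
  "admissible q fs a h =
     {f. C_on 3 f UNIV \<and> f a \<in> range fs \<and> C_on 3 (q (f a)) (f ` {a..a + h})}"

definition nonlinear_on ::
  "(real \<Rightarrow> real) set \<Rightarrow> real set \<Rightarrow> ((real \<Rightarrow> real) \<Rightarrow> real \<Rightarrow> real) \<Rightarrow> bool" where
  "nonlinear_on A X N \<longleftrightarrow>
     (\<exists>f\<in>A. \<exists>g\<in>A. \<exists>c d. (\<lambda>x. c * f x + d * g x) \<in> A \<and>
        (\<exists>\<xi>\<in>X. N (\<lambda>x. c * f x + d * g x) \<xi> \<noteq> c * N f \<xi> + d * N g \<xi>))"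

definition alpha_f :: "(real \<Rightarrow> real) \<Rightarrow> real \<Rightarrow> real \<Rightarrow> (real \<Rightarrow> real) \<Rightarrow> real" where
  "alpha_f fs a h f = (inv fs (f (a + h)) - inv fs (f a)) / h"

definition beta_f :: "(real \<Rightarrow> real) \<Rightarrow> real \<Rightarrow> real \<Rightarrow> (real \<Rightarrow> real) \<Rightarrow> real" where
  "beta_f fs a h f = ((a + h) * inv fs (f a) - a * inv fs (f (a + h))) / h"

definition SL ::
  "(real \<Rightarrow> real) \<Rightarrow> (real \<Rightarrow> real) \<Rightarrow> (real \<Rightarrow> real) \<Rightarrow> real \<Rightarrow> real" where
  "SL p s u x = - deriv (\<lambda>t. p t * deriv u t) x + s x * u x"

definition SL_affine ::
  "(real \<Rightarrow> real) \<Rightarrow> (real \<Rightarrow> real) \<Rightarrow> real \<Rightarrow> real \<Rightarrow> (real \<Rightarrow> real) \<Rightarrow> real \<Rightarrow> real" where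
  "SL_affine p s \<alpha> \<beta> u x =
     - deriv (\<lambda>t. p (\<alpha> * t + \<beta>) * deriv u t) x + \<alpha>\<^sup>2 * s (\<alpha> * x + \<beta>) * u x"

definition dirichlet_solution ::
  "((real \<Rightarrow> real) \<Rightarrow> real \<Rightarrow> real) \<Rightarrow> real \<Rightarrow> real \<Rightarrow> (real \<Rightarrow> real) \<Rightarrow> (real \<Rightarrow> real) \<Rightarrow> bool" where
  "dirichlet_solution D a b g u \<longleftrightarrow>
     continuous_on {a..b} u \<and> C_on 2 u {a<..<b} \<and>
     (\<forall>x\<in>{a<..<b}. D u x = g x) \<and> u a = 0 \<and> u b = 0"

text \<open>Continuity of the kernel on the closed square is part of the definition; it makes the
  kernel unique there.\<close>

definition green_function ::
  "((real \<Rightarrow> real) \<Rightarrow> real \<Rightarrow> real) \<Rightarrow> real \<Rightarrow> real \<Rightarrow> (real \<Rightarrow> real \<Rightarrow> real) \<Rightarrow> bool" where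
  "green_function D a b G \<longleftrightarrow>
     continuous_on ({a..b} \<times> {a..b}) (\<lambda>(x, y). G x y) \<and>
     (\<forall>g. continuous_on {a..b} g \<longrightarrow>
        dirichlet_solution D a b g (\<lambda>x. integral {a..b} (\<lambda>y. G x y * g y)))"

end

theory Submission
  imports Defs
begin

text \<open>All three estimates compare \<open>f\<close> with affine reparametrisations of \<open>fs\<close>, on which the formula
  makes no error.

  For the first one the error on \<open>[a, \<xi>]\<close> is regarded as a function of \<open>\<xi>\<close>. Its third derivative is
  \<open>- N[f](\<xi>)\<close> (\<open>error_deriv_DERIV\<close>), and its value and first two derivatives at \<open>\<xi> = a\<close> involve only
  \<open>q(c, c)\<close> and \<open>q\<^sup>(\<^sup>0\<^sup>,\<^sup>1\<^sup>)(c, c)\<close> for \<open>c = f(a)\<close>. For a reparametrisation of \<open>fs\<close> the error is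
  identically zero, so \<open>N\<close> annihilates it; moreover, choosing it such that it takes the value \<open>c\<close> at
  \<open>a\<close> yields \<open>q(c, c) = c\<close> and \<open>q\<^sup>(\<^sup>0\<^sup>,\<^sup>1\<^sup>)(c, c) = 1/2\<close> (\<open>affinely_exact_diagonal\<close>). With these
  values the error of every admissible \<open>f\<close> vanishes to third order at \<open>a\<close>, and Taylor's theorem
  gives the bound. The third derivative also shows \<open>q\<^sup>(\<^sup>0\<^sup>,\<^sup>2\<^sup>)(c, c) \<noteq> 0\<close> for some \<open>c\<close>, as \<open>fs\<close>
  has no zero and therefore is not affine; this makes \<open>N\<close> quadratic in the slope of straight lines,
  hence nonlinear.

  For the other two, the numbers \<open>\<alpha>\<^sub>f, \<beta>\<^sub>f\<close> are chosen such that \<open>g(x) = fs (\<alpha>\<^sub>f x + \<beta>\<^sub>f)\<close> agrees with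
  \<open>f\<close> at both nodes. Then the error is the integral of \<open>g - f\<close>, a function that vanishes at \<open>a\<close> and
  \<open>a + h\<close> (\<open>quad_error_eq_integral\<close>). It can be bounded through its second derivative, as for the
  trapezoidal rule (\<open>trapezoidal_bound\<close>), or through the operator \<open>L\<close> with coefficients substituted
  by \<open>x \<mapsto> \<alpha>\<^sub>f x + \<beta>\<^sub>f\<close>, which annihilates \<open>g\<close>: the Green function represents \<open>f - g\<close> by \<open>L f\<close>
  (\<open>green_function_represents\<close>). The latter requires uniqueness for the Dirichlet problem, which is
  deduced from the existence of the Green function and the self-adjointness of \<open>L\<close>
  (\<open>dirichlet_uniqueness\<close>).\<close>

section \<open>Iterated derivatives\<close>

lemma C_on_DERIV:
  assumes "C_on k g S" "i < k" "x \<in> S"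
  shows "((deriv ^^ i) g has_real_derivative (deriv ^^ Suc i) g x) (at x)"
  using assms unfolding C_on_def by blast

lemma C_on_isCont:
  assumes "C_on k g S" "i \<le> k" "x \<in> S"
  shows "isCont ((deriv ^^ i) g) x"
proof (cases "i = k")
  case True
  then show ?thesis
    using assms unfolding C_on_def by (metis continuous_on_eq_continuous_at subsetD)
next
  case False
  then show ?thesis
    using C_on_DERIV[OF assms(1) _ assms(3), of i] assms(2) DERIV_isCont by fastforce
qed

lemma C_on_continuous_on:
  "C_on k g S \<Longrightarrow> i \<le> k \<Longrightarrow> continuous_on S ((deriv ^^ i) g)"
  by (meson C_on_isCont continuous_at_imp_continuous_on)

lemma C_on_imp_continuous_on:
  assumes "C_on k g UNIV"
  shows "continuous_on X g"
  using C_on_continuous_on[OF assms, of 0] by (auto intro: continuous_on_subset)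

text \<open>The instances of \<open>C_on_DERIV\<close> up to order three, in the notation \<^term>\<open>deriv g\<close> and
  \<^term>\<open>(deriv ^^ 2) g\<close> in which the differential operators are written.\<close>

lemma C_on_DERIV_low:
  assumes "C_on k g S" "x \<in> S"
  shows "1 \<le> k \<Longrightarrow> (g has_real_derivative deriv g x) (at x)"
    and "2 \<le> k \<Longrightarrow> (deriv g has_real_derivative (deriv ^^ 2) g x) (at x)"
    and "3 \<le> k \<Longrightarrow> ((deriv ^^ 2) g has_real_derivative (deriv ^^ 3) g x) (at x)"
  using C_on_DERIV[OF assms(1) _ assms(2), of 0] C_on_DERIV[OF assms(1) _ assms(2), of 1]
    C_on_DERIV[OF assms(1) _ assms(2), of 2]
  by (auto simp: numeral_2_eq_2 numeral_3_eq_3)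

text \<open>A chain of functions, each the derivative of its predecessor on the whole line, has to be the
  chain of iterated derivatives. This is how all concrete higher derivatives below are computed.\<close>

lemma iterated_deriv_eqI:
  assumes "D 0 = g"
    and "\<And>i x. i < k \<Longrightarrow> (D i has_real_derivative D (Suc i) x) (at x)"
    and "i \<le> k"
  shows "(deriv ^^ i) g = D i"
  using assms(3)
proof (induction i)
  case 0
  then show ?case by (simp add: assms(1))
next
  case (Suc i)
  then have "deriv (D i) = D (Suc i)"
    using assms(2)[of i] DERIV_imp_deriv by fastforce
  with Suc show ?case by simp
qed

lemma C_on_UNIV_I:
  assumes "D 0 = g"
    and "\<And>i x. i < k \<Longrightarrow> (D i has_real_derivative D (Suc i) x) (at x)"
    and "continuous_on UNIV (D k)"
  shows "C_on k g UNIV"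
  unfolding C_on_def
  using assms(2,3) iterated_deriv_eqI[OF assms(1,2)]
  by (intro exI[of _ UNIV]) (simp del: funpow.simps)

lemma affine_comp_DERIV:
  assumes "C_on k g UNIV" "i < k"
  shows "((\<lambda>x. \<alpha> ^ i * (deriv ^^ i) g (\<alpha> * x + \<beta>)) has_real_derivative
          \<alpha> ^ Suc i * (deriv ^^ Suc i) g (\<alpha> * x + \<beta>)) (at x)"
proof -
  have "((\<lambda>x. (deriv ^^ i) g (\<alpha> * x + \<beta>)) has_real_derivative
          (deriv ^^ Suc i) g (\<alpha> * x + \<beta>) * \<alpha>) (at x)"
    by (rule DERIV_chain2[OF C_on_DERIV[OF assms UNIV_I]]) (auto intro!: derivative_eq_intros)
  from DERIV_cmult[OF this, of "\<alpha> ^ i"] show ?thesis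
    by (simp add: mult_ac)
qed

lemma iterated_deriv_affine_comp:
  assumes "C_on k g UNIV" "i \<le> k"
  shows "(deriv ^^ i) (affine_comp g \<alpha> \<beta>) = (\<lambda>x. \<alpha> ^ i * (deriv ^^ i) g (\<alpha> * x + \<beta>))"
  by (rule iterated_deriv_eqI[where D = "\<lambda>i x. \<alpha> ^ i * (deriv ^^ i) g (\<alpha> * x + \<beta>)",
        OF _ affine_comp_DERIV[OF assms(1)] assms(2)])
    (simp_all add: affine_comp_def)

lemma continuous_on_affine_compose:
  fixes g :: "real \<Rightarrow> real"
  assumes "continuous_on UNIV g"
  shows "continuous_on X (\<lambda>x. g (\<alpha> * x + \<beta>))"
  by (rule continuous_on_compose2[OF assms, of X "\<lambda>x. \<alpha> * x + \<beta>"]) (auto intro!: continuous_intros)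

lemma C_on_affine_comp:
  assumes "C_on k g UNIV"
  shows "C_on k (affine_comp g \<alpha> \<beta>) UNIV"
proof (rule C_on_UNIV_I[where D = "\<lambda>i x. \<alpha> ^ i * (deriv ^^ i) g (\<alpha> * x + \<beta>)",
      OF _ affine_comp_DERIV[OF assms]])
  have "continuous_on UNIV ((deriv ^^ k) g)"
    by (rule C_on_continuous_on[OF assms order_refl])
  then show "continuous_on UNIV (\<lambda>x. \<alpha> ^ k * (deriv ^^ k) g (\<alpha> * x + \<beta>))"
    by (intro continuous_on_mult_left continuous_on_affine_compose)
qed (simp add: affine_comp_def)

lemma iterated_deriv_affine:
  fixes c \<epsilon> a :: real
  shows "deriv (\<lambda>x. c + \<epsilon> * (x - a)) = (\<lambda>_. \<epsilon>)"
    and "(deriv ^^ 2) (\<lambda>x. c + \<epsilon> * (x - a)) = (\<lambda>_. 0)"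
    and "C_on k (\<lambda>x. c + \<epsilon> * (x - a)) UNIV"
proof -
  let ?D = "\<lambda>i x. if i = 0 then c + \<epsilon> * (x - a) else if i = Suc 0 then \<epsilon> else 0"
  have D: "(?D i has_real_derivative ?D (Suc i) x) (at x)" for i x
    by (cases "i = 0"; cases "i = 1") (auto intro!: derivative_eq_intros)
  have "(deriv ^^ i) (\<lambda>x. c + \<epsilon> * (x - a)) = ?D i" for i
    by (rule iterated_deriv_eqI[where D = ?D and k = i]) (simp, rule D, simp)
  from this[of 1] this[of 2]
  show "deriv (\<lambda>x. c + \<epsilon> * (x - a)) = (\<lambda>_. \<epsilon>)"
    and "(deriv ^^ 2) (\<lambda>x. c + \<epsilon> * (x - a)) = (\<lambda>_. 0)"
    by auto
  show "C_on k (\<lambda>x. c + \<epsilon> * (x - a)) UNIV"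
    by (rule C_on_UNIV_I[where D = ?D], simp, rule D) (cases "k = 0"; auto intro!: continuous_intros)
qed

lemma ex_antiderivative:
  fixes f :: "real \<Rightarrow> real"
  assumes "continuous_on UNIV f"
  shows "\<exists>\<Phi>. \<forall>x. (\<Phi> has_real_derivative f x) (at x)"
proof -
  have "isCont f x" for x
    using assms by (simp add: continuous_on_eq_continuous_at)
  then show ?thesis
    using einterval_antiderivative[of "-\<infinity>" \<infinity> f]
    by (auto simp: has_real_derivative_iff_has_vector_derivative)
qed

lemma has_integral_DERIV:
  fixes f :: "real \<Rightarrow> real"
  assumes "a \<le> b" and "\<And>x. x \<in> {a..b} \<Longrightarrow> (\<Phi> has_real_derivative f x) (at x)"
  shows "(f has_integral \<Phi> b - \<Phi> a) {a..b}"
  by (rule fundamental_theorem_of_calculus[OF assms(1)])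
    (use assms(2) in \<open>auto simp: has_real_derivative_iff_has_vector_derivative
       intro: has_vector_derivative_at_within\<close>)

lemma integral_antiderivative:
  fixes f :: "real \<Rightarrow> real"
  assumes "\<And>x. (\<Phi> has_real_derivative f x) (at x)" "a \<le> b"
  shows "integral {a..b} f = \<Phi> b - \<Phi> a"
  using has_integral_DERIV[OF assms(2,1)] by (rule integral_unique)

text \<open>In the reals a supremum is meaningful only for a bounded set; continuity on a compact interval
  supplies the bound for every supremum that occurs in the error estimates.\<close>

lemma abs_le_SUP_of_continuous:
  fixes g :: "real \<Rightarrow> real"
  assumes "continuous_on {a..b} g" "x \<in> {a..b}"
  shows "\<bar>g x\<bar> \<le> (SUP \<xi>\<in>{a..b}. \<bar>g \<xi>\<bar>)"
proof (rule cSUP_upper[OF assms(2)])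
  have "compact ((\<lambda>\<xi>. \<bar>g \<xi>\<bar>) ` {a..b})"
    by (intro compact_continuous_image continuous_intros assms(1)) auto
  then show "bdd_above ((\<lambda>\<xi>. \<bar>g \<xi>\<bar>) ` {a..b})"
    by (simp add: bounded_imp_bdd_above compact_imp_bounded)
qed

section \<open>The error as a function of the right end point\<close>

text \<open>For \<open>m = 0\<close> this is the quadrature error on \<open>[a, \<xi>]\<close>, where \<open>\<Phi>\<close> is an antiderivative of
  \<open>f\<close>; for \<open>m = 1, 2, 3\<close> it is the explicit form of its \<open>m\<close>-th derivative in \<open>\<xi>\<close>. Writing the
  error with \<open>\<Phi>\<close> instead of an integral over \<open>[a, \<xi>]\<close> makes it meaningful, and smooth, also for
  \<open>\<xi> < a\<close>.\<close>

definition error_deriv ::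
  "(real \<Rightarrow> real \<Rightarrow> real) \<Rightarrow> real \<Rightarrow> (real \<Rightarrow> real) \<Rightarrow> (real \<Rightarrow> real) \<Rightarrow> nat \<Rightarrow> real \<Rightarrow> real"
where
  "error_deriv q a f \<Phi> m \<xi> =
     (if m = 0 then (\<xi> - a) * q (f a) (f \<xi>) - (\<Phi> \<xi> - \<Phi> a)
      else if m = 1 then q (f a) (f \<xi>) + (\<xi> - a) * (deriv f \<xi> * pd 0 1 q (f a) (f \<xi>)) - f \<xi>
      else if m = 2 then 2 * deriv f \<xi> * pd 0 1 q (f a) (f \<xi>)
        + (\<xi> - a) * ((deriv ^^ 2) f \<xi> * pd 0 1 q (f a) (f \<xi>)
                     + (deriv f \<xi>)\<^sup>2 * pd 0 2 q (f a) (f \<xi>))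
        - deriv f \<xi>
      else - err_op q a f \<xi>)"

text \<open>Differentiating the error three times in its right end point produces exactly the operator
  \<open>- N[f]\<close>; this is where \<^const>\<open>err_op\<close> comes from.\<close>

lemma error_deriv_DERIV:
  assumes f: "C_on 3 f UNIV" and Q: "C_on 3 (q (f a)) S" and S: "f \<xi> \<in> S"
    and \<Phi>: "\<And>x. (\<Phi> has_real_derivative f x) (at x)" and m: "m < 3"
  shows "(error_deriv q a f \<Phi> m has_real_derivative error_deriv q a f \<Phi> (Suc m) \<xi>) (at \<xi>)"
proof -
  note f' = C_on_DERIV_low[OF f UNIV_I, simplified]
  have Q': "((\<lambda>x. q (f a) (f x)) has_real_derivative pd 0 1 q (f a) (f \<xi>) * deriv f \<xi>) (at \<xi>)"
    "((\<lambda>x. pd 0 1 q (f a) (f x)) has_real_derivative pd 0 2 q (f a) (f \<xi>) * deriv f \<xi>) (at \<xi>)"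
    "((\<lambda>x. pd 0 2 q (f a) (f x)) has_real_derivative pd 0 3 q (f a) (f \<xi>) * deriv f \<xi>) (at \<xi>)"
    using DERIV_chain2[OF C_on_DERIV_low(1)[OF Q S] f'(1)]
      DERIV_chain2[OF C_on_DERIV_low(2)[OF Q S] f'(1)]
      DERIV_chain2[OF C_on_DERIV_low(3)[OF Q S] f'(1)]
    by (simp_all add: pd_def)
  have E: "error_deriv q a f \<Phi> 0 = (\<lambda>\<xi>. (\<xi> - a) * q (f a) (f \<xi>) - (\<Phi> \<xi> - \<Phi> a))"
    "error_deriv q a f \<Phi> 1 =
       (\<lambda>\<xi>. q (f a) (f \<xi>) + (\<xi> - a) * (deriv f \<xi> * pd 0 1 q (f a) (f \<xi>)) - f \<xi>)"
    "error_deriv q a f \<Phi> 2 = (\<lambda>\<xi>. 2 * deriv f \<xi> * pd 0 1 q (f a) (f \<xi>)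
        + (\<xi> - a) * ((deriv ^^ 2) f \<xi> * pd 0 1 q (f a) (f \<xi>)
                     + (deriv f \<xi>)\<^sup>2 * pd 0 2 q (f a) (f \<xi>))
        - deriv f \<xi>)"
    "error_deriv q a f \<Phi> 3 = (\<lambda>\<xi>. - err_op q a f \<xi>)"
    by (simp_all add: error_deriv_def fun_eq_iff)
  have "(error_deriv q a f \<Phi> 0 has_real_derivative error_deriv q a f \<Phi> 1 \<xi>) (at \<xi>)"
    unfolding E by (rule derivative_eq_intros f' Q' \<Phi> refl)+ algebra
  moreover have "(error_deriv q a f \<Phi> 1 has_real_derivative error_deriv q a f \<Phi> 2 \<xi>) (at \<xi>)"
    unfolding E by (rule derivative_eq_intros f' Q' refl)+ algebra
  moreover have "(error_deriv q a f \<Phi> 2 has_real_derivative error_deriv q a f \<Phi> 3 \<xi>) (at \<xi>)"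
    unfolding E err_op_def by ((rule derivative_eq_intros f' Q' refl)+; simp; algebra)
  moreover have "m = 0 \<or> m = 1 \<or> m = 2" using m by linarith
  ultimately show ?thesis
    by (elim disjE) (simp_all only: numeral_2_eq_2 numeral_3_eq_3 One_nat_def)
qed

lemma err_op_continuous_on:
  assumes f: "C_on 3 f UNIV" and Q: "C_on 3 (q (f a)) (f ` X)"
  shows "continuous_on X (err_op q a f)"
proof -
  have fc: "continuous_on X ((deriv ^^ i) f)" if "i \<le> 3" for i
    using C_on_continuous_on[OF f that] continuous_on_subset by blast
  have Qc: "continuous_on X (\<lambda>x. pd 0 i q (f a) (f x))" if "i \<le> 3" for i
    using continuous_on_compose2[OF C_on_continuous_on[OF Q that] fc[of 0]]
    by (simp add: pd_def)
  show ?thesis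
    unfolding err_op_def[abs_def]
    using fc[of 1] fc[of 2] fc[of 3] Qc by (auto intro!: continuous_intros)
qed

text \<open>Exactness gives the claim for \<open>\<xi> > a\<close> at once. For \<open>\<xi> < a\<close> the reflection \<open>x \<mapsto> 2 a - x\<close> turns
  the interval \<open>[\<xi>, a]\<close> into one that starts at \<open>a\<close>, and it turns an affine reparametrisation of
  \<open>fs\<close> into another one, for which exactness applies.\<close>

lemma affinely_exact_error_eq_0:
  assumes exact: "affinely_exact q a fs"
    and \<Phi>: "\<And>x. (\<Phi> has_real_derivative affine_comp fs \<alpha> \<beta> x) (at x)"
  shows "error_deriv q a (affine_comp fs \<alpha> \<beta>) \<Phi> 0 \<xi> = 0"
proof -
  consider "\<xi> = a" | "\<xi> > a" | "\<xi> < a" by linarith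
  then show ?thesis
  proof cases
    case 1
    then show ?thesis by (simp add: error_deriv_def)
  next
    case 2
    then have "quad q a (\<xi> - a) (affine_comp fs \<alpha> \<beta>) = exact_int a (\<xi> - a) (affine_comp fs \<alpha> \<beta>)"
      using exact unfolding affinely_exact_def by simp
    with 2 show ?thesis
      by (simp add: quad_def exact_int_def error_deriv_def integral_antiderivative[OF \<Phi>])
  next
    case 3
    let ?g = "affine_comp fs (- \<alpha>) (\<beta> + 2 * \<alpha> * a)"
    have g: "?g x = affine_comp fs \<alpha> \<beta> (2 * a - x)" for x
      by (simp add: affine_comp_def algebra_simps)
    have "((\<lambda>x. - \<Phi> (2 * a - x)) has_real_derivative ?g x) (at x)" for x
      unfolding g by (rule DERIV_chain2[OF \<Phi>] derivative_eq_intros refl | simp)+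
    from integral_antiderivative[OF this, of a "2 * a - \<xi>"] 3
    have "integral {a..2 * a - \<xi>} ?g = - \<Phi> \<xi> + \<Phi> a"
      by simp
    moreover have "quad q a (a - \<xi>) ?g = exact_int a (a - \<xi>) ?g"
      using exact 3 unfolding affinely_exact_def by simp
    moreover have "?g a = affine_comp fs \<alpha> \<beta> a" "?g (2 * a - \<xi>) = affine_comp fs \<alpha> \<beta> \<xi>"
      unfolding g by simp_all
    ultimately have "(a - \<xi>) * q (affine_comp fs \<alpha> \<beta> a) (affine_comp fs \<alpha> \<beta> \<xi>) = - \<Phi> \<xi> + \<Phi> a"
      by (simp add: quad_def exact_int_def)
    then show ?thesis
      by (simp add: error_deriv_def algebra_simps)
  qed
qed

text \<open>An identically vanishing error has vanishing derivatives, at \<open>\<xi> = a\<close> as well.\<close>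

lemma affinely_exact_error_deriv_eq_0:
  assumes exact: "affinely_exact q a fs" and fs: "C_on 3 fs UNIV"
    and q: "\<And>c. c \<in> range fs \<Longrightarrow> C_on 3 (q c) (range fs)"
    and \<Phi>: "\<And>x. (\<Phi> has_real_derivative affine_comp fs \<alpha> \<beta> x) (at x)" and m: "m \<le> 3"
  shows "error_deriv q a (affine_comp fs \<alpha> \<beta>) \<Phi> m = (\<lambda>_. 0)"
  using m
proof (induction m)
  case 0
  show ?case by (rule ext) (rule affinely_exact_error_eq_0[OF exact \<Phi>])
next
  case (Suc m)
  let ?f = "affine_comp fs \<alpha> \<beta>"
  have r: "?f x \<in> range fs" for x by (simp add: affine_comp_def)
  show ?case
  proof
    fix \<xi>
    have "(error_deriv q a ?f \<Phi> m has_real_derivative error_deriv q a ?f \<Phi> (Suc m) \<xi>) (at \<xi>)"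
    proof (rule error_deriv_DERIV)
      show "C_on 3 ?f UNIV" by (rule C_on_affine_comp[OF fs])
      show "C_on 3 (q (?f a)) (range fs)" by (rule q[OF r])
      show "?f \<xi> \<in> range fs" by (rule r)
      show "m < 3" using Suc.prems by simp
    qed (rule \<Phi>)
    moreover have "error_deriv q a ?f \<Phi> m = (\<lambda>_. 0)"
      by (rule Suc.IH) (use Suc.prems in simp)
    ultimately have "((\<lambda>_. 0) has_real_derivative error_deriv q a ?f \<Phi> (Suc m) \<xi>) (at \<xi>)"
      by (simp only:)
    then show "error_deriv q a ?f \<Phi> (Suc m) \<xi> = 0"
      by (rule DERIV_unique[OF _ DERIV_const])
  qed
qed

lemma affinely_exact_err_op_eq_0:
  assumes exact: "affinely_exact q a fs" and fs: "C_on 3 fs UNIV"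
    and q: "\<And>c. c \<in> range fs \<Longrightarrow> C_on 3 (q c) (range fs)"
  shows "err_op q a (affine_comp fs \<alpha> \<beta>) \<xi> = 0"
proof -
  obtain \<Phi> where \<Phi>: "\<And>x. (\<Phi> has_real_derivative affine_comp fs \<alpha> \<beta> x) (at x)"
    using ex_antiderivative[OF C_on_imp_continuous_on[OF C_on_affine_comp[OF fs, of \<alpha> \<beta>]]]
    by blast
  have "error_deriv q a (affine_comp fs \<alpha> \<beta>) \<Phi> 3 = (\<lambda>_. 0)"
    by (rule affinely_exact_error_deriv_eq_0[OF exact fs]) (erule q, rule \<Phi>, rule order_refl)
  then have "error_deriv q a (affine_comp fs \<alpha> \<beta>) \<Phi> 3 \<xi> = 0"
    by (rule fun_cong)
  then show ?thesis
    by (simp add: error_deriv_def)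
qed

text \<open>The behaviour of \<open>q\<close> at a diagonal point \<open>(c, c)\<close> with \<open>c = fs b\<close>, \<open>fs'(b) \<noteq> 0\<close> is read
  off from the first three derivatives at \<open>\<xi> = a\<close> of the error for the translate of \<open>fs\<close> that takes the value
  \<open>c\<close> at \<open>a\<close>: the formula is consistent, it weighs both nodes equally to first order, and its
  second derivative encodes the curvature of \<open>fs\<close>.\<close>

lemma affinely_exact_diagonal:
  assumes exact: "affinely_exact q a fs" and fs: "C_on 3 fs UNIV"
    and q: "\<And>c. c \<in> range fs \<Longrightarrow> C_on 3 (q c) (range fs)"
    and nz: "deriv fs b \<noteq> 0"
  shows "q (fs b) (fs b) = fs b" and "pd 0 1 q (fs b) (fs b) = 1 / 2"
    and "(deriv ^^ 2) fs b = - 6 * (deriv fs b)\<^sup>2 * pd 0 2 q (fs b) (fs b)"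
proof -
  let ?f = "affine_comp fs 1 (b - a)"
  obtain \<Phi> where \<Phi>: "\<And>x. (\<Phi> has_real_derivative ?f x) (at x)"
    using ex_antiderivative[OF C_on_imp_continuous_on[OF C_on_affine_comp[OF fs, of 1 "b - a"]]]
    by blast
  have z: "error_deriv q a ?f \<Phi> m a = 0" if "m \<le> 3" for m
    by (rule fun_cong, rule affinely_exact_error_deriv_eq_0[OF exact fs])
      (erule q, rule \<Phi>, rule that)
  have fa: "?f a = fs b" "deriv ?f a = deriv fs b" "(deriv ^^ 2) ?f a = (deriv ^^ 2) fs b"
    using fun_cong[OF iterated_deriv_affine_comp[OF fs, of 1 1 "b - a"], of a]
      fun_cong[OF iterated_deriv_affine_comp[OF fs, of 2 1 "b - a"], of a]
    by (simp_all add: affine_comp_def[of fs 1 "b - a", THEN fun_cong])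
  show "q (fs b) (fs b) = fs b"
    using z[of 1] by (simp add: error_deriv_def fa)
  show half: "pd 0 1 q (fs b) (fs b) = 1 / 2"
    using z[of 2] nz by (simp add: error_deriv_def fa)
  show "(deriv ^^ 2) fs b = - 6 * (deriv fs b)\<^sup>2 * pd 0 2 q (fs b) (fs b)"
    using z[of 3] by (simp add: error_deriv_def err_op_def fa half[unfolded One_nat_def])
qed

text \<open>By \<open>affinely_exact_diagonal\<close> the error for any admissible \<open>f\<close>, as a function of the right end
  point, vanishes to third order at \<open>a\<close>: only the values at \<open>(f a, f a)\<close> enter, and \<open>f a\<close> lies
  in the range of \<open>fs\<close>. The Lagrange remainder of order three is therefore all that is left.\<close>

lemma quad_error_le_err_op:
  assumes h: "h > 0" and exact: "affinely_exact q a fs" and fs: "C_on 3 fs UNIV"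
    and nz: "\<And>x. deriv fs x \<noteq> 0"
    and q: "\<And>c. c \<in> range fs \<Longrightarrow> C_on 3 (q c) (range fs)"
    and adm: "f \<in> admissible q fs a h"
  shows "\<bar>quad q a h f - exact_int a h f\<bar>
    \<le> h ^ 3 / 6 * (SUP \<xi>\<in>{a..a + h}. \<bar>err_op q a f \<xi>\<bar>)"
proof -
  have f: "C_on 3 f UNIV" and Q: "C_on 3 (q (f a)) (f ` {a..a + h})"
    using adm by (auto simp: admissible_def)
  obtain b where b: "f a = fs b"
    using adm by (auto simp: admissible_def)
  note diag = affinely_exact_diagonal[OF exact fs q nz, of b]
  obtain \<Phi> where \<Phi>: "\<And>x. (\<Phi> has_real_derivative f x) (at x)"
    using ex_antiderivative[OF C_on_imp_continuous_on[OF f]] by blast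
  let ?E = "error_deriv q a f \<Phi>"
  have "?E m a = 0" if "m < 3" for m
  proof -
    consider "m = 0" | "m = 1" | "m = 2" using \<open>m < 3\<close> by linarith
    then show ?thesis
      by cases (simp_all add: error_deriv_def b diag(1) diag(2)[unfolded One_nat_def])
  qed
  moreover have "\<exists>t. a < t \<and> t < a + h \<and>
      ?E 0 (a + h) = (\<Sum>m<3. ?E m a / fact m * (a + h - a) ^ m) + ?E 3 t / fact 3 * (a + h - a) ^ 3"
  proof (rule Taylor_up)
    show "\<forall>m t. m < 3 \<and> a \<le> t \<and> t \<le> a + h \<longrightarrow>
        (?E m has_real_derivative ?E (Suc m) t) (at t)"
      by (intro allI impI error_deriv_DERIV[where S = "f ` {a..a + h}"] f Q \<Phi>) auto
  qed (use h in auto)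
  ultimately obtain t where t: "a < t" "t < a + h" "?E 0 (a + h) = ?E 3 t / 6 * h ^ 3"
    by (auto simp: fact_numeral)
  have "quad q a h f - exact_int a h f = ?E 0 (a + h)"
    using h by (simp add: error_deriv_def quad_def exact_int_def integral_antiderivative[OF \<Phi>])
  also have "\<bar>\<dots>\<bar> = h ^ 3 / 6 * \<bar>err_op q a f t\<bar>"
    using t(3) h by (simp add: error_deriv_def abs_mult)
  also have "\<dots> \<le> h ^ 3 / 6 * (SUP \<xi>\<in>{a..a + h}. \<bar>err_op q a f \<xi>\<bar>)"
    using t(1,2) h
    by (intro mult_left_mono abs_le_SUP_of_continuous err_op_continuous_on f Q) auto
  finally show ?thesis .
qed

text \<open>If \<open>fs''\<close> vanished identically, \<open>fs\<close> would be affine with nonzero slope and hence have a zero.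
  So \<open>fs''\<close> is nonzero somewhere, and then \<open>q\<^sup>(\<^sup>0\<^sup>,\<^sup>2\<^sup>)(c, c) \<noteq> 0\<close> for some \<open>c\<close> in the range.
  For \<open>f(x) = c + \<delta> (x - a)\<close> the value \<open>N[f](a)\<close> is a nonzero multiple of \<open>\<delta>\<^sup>2\<close>, so that halving
  the slope, by averaging \<open>f\<close> with the constant \<open>c\<close>, does not halve it.\<close>

lemma nonlinear_err_op:
  assumes h: "h > 0" and exact: "affinely_exact q a fs" and fs: "C_on 3 fs UNIV"
    and nz: "\<And>x. fs x \<noteq> 0" "\<And>x. deriv fs x \<noteq> 0"
    and q: "\<And>c. c \<in> range fs \<Longrightarrow> C_on 3 (q c) (range fs)"
  shows "nonlinear_on (admissible q fs a h) {a..a + h} (err_op q a)"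
proof -
  note diag = affinely_exact_diagonal[OF exact fs q nz(2)]
  have "\<exists>b. (deriv ^^ 2) fs b \<noteq> 0"
  proof (rule ccontr)
    assume "\<nexists>b. (deriv ^^ 2) fs b \<noteq> 0"
    then have "(deriv fs has_real_derivative 0) (at x)" for x
      using C_on_DERIV_low(2)[OF fs UNIV_I, of x] by simp
    then have "deriv fs x = deriv fs 0" for x
      by (intro DERIV_isconst_all allI)
    then have "(fs has_real_derivative deriv fs 0) (at x)" for x
      using C_on_DERIV_low(1)[OF fs UNIV_I one_le_numeral] by metis
    then have "((\<lambda>x. fs x - deriv fs 0 * x) has_real_derivative 0) (at x)" for x
      by (auto intro!: derivative_eq_intros)
    then have "fs x - deriv fs 0 * x = fs 0 - deriv fs 0 * 0" for x
      by (intro DERIV_isconst_all[where f = "\<lambda>x. fs x - deriv fs 0 * x"] allI)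
    \<comment> \<open>the zero of the affine function\<close>
    from this[of "- fs 0 / deriv fs 0"] show False
      using nz by simp
  qed
  then obtain b where b: "(deriv ^^ 2) fs b \<noteq> 0" by blast
  define c where "c = fs b"
  have q2: "pd 0 2 q c c \<noteq> 0"
    using diag(3)[of b] b by (auto simp: c_def)
  have "C_on 3 (q c) (range fs)"
    by (simp add: q c_def)
  then obtain T where T: "open T" "c \<in> T" and QT: "C_on 3 (q c) T"
    unfolding C_on_def c_def by blast
  obtain e where e: "e > 0" "ball c e \<subseteq> T"
    using T open_contains_ball by blast
  \<comment> \<open>With this slope the line stays within distance \<open>e/2\<close> of \<open>c\<close> on \<open>[a, a + h]\<close>,
    where \<open>q c\<close> is smooth.\<close>
  define \<epsilon> where "\<epsilon> = e / (2 * h)"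
  have \<epsilon>: "\<epsilon> > 0" using e h by (simp add: \<epsilon>_def)
  have adm: "(\<lambda>x. c + \<delta> * (x - a)) \<in> admissible q fs a h" if "0 \<le> \<delta>" "\<delta> \<le> \<epsilon>" for \<delta>
  proof -
    have "c + \<delta> * (x - a) \<in> ball c e" if "x \<in> {a..a + h}" for x
    proof -
      have "\<delta> * (x - a) \<le> \<epsilon> * h"
        using that \<open>\<delta> \<le> \<epsilon>\<close> \<epsilon> by (intro mult_mono) auto
      also have "\<dots> < e" using e h by (simp add: \<epsilon>_def)
      finally show ?thesis
        using that \<open>0 \<le> \<delta>\<close> by (simp add: dist_real_def)
    qed
    then have "C_on 3 (q c) ((\<lambda>x. c + \<delta> * (x - a)) ` {a..a + h})"
      using QT e(2) unfolding C_on_def by (meson image_subsetI subset_trans)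
    then show ?thesis
      using iterated_deriv_affine(3) by (simp add: admissible_def c_def)
  qed
  have N: "err_op q a (\<lambda>x. c + \<delta> * (x - a)) a = - 3 * \<delta>\<^sup>2 * pd 0 2 q c c" for \<delta>
    by (simp add: err_op_def iterated_deriv_affine)
  let ?f = "\<lambda>x. c + \<epsilon> * (x - a)" and ?g = "\<lambda>x. c + 0 * (x - a)"
  have comb: "(\<lambda>x. 1/2 * ?f x + 1/2 * ?g x) = (\<lambda>x. c + (\<epsilon>/2) * (x - a))"
    by (simp add: fun_eq_iff field_simps)
  have "err_op q a (\<lambda>x. 1/2 * ?f x + 1/2 * ?g x) a
      \<noteq> 1/2 * err_op q a ?f a + 1/2 * err_op q a ?g a"
    unfolding comb N using q2 \<epsilon> by (simp add: power2_eq_square)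
  moreover have "a \<in> {a..a + h}" using h by simp
  moreover have "(\<lambda>x. 1/2 * ?f x + 1/2 * ?g x) \<in> admissible q fs a h"
    unfolding comb using \<epsilon> by (intro adm) auto
  moreover have "?f \<in> admissible q fs a h" "?g \<in> admissible q fs a h"
    using \<epsilon> by (intro adm; simp)+
  ultimately show ?thesis
    unfolding nonlinear_on_def
    by - (rule bexI[of _ ?f], rule bexI[of _ ?g], rule exI[of _ "1/2"], rule exI[of _ "1/2"],
        rule conjI, assumption, rule bexI[of _ a], assumption+)
qed

section \<open>The trapezoidal bound\<close>

text \<open>With \<open>Z(x) = (x - a) (b - x) w'(x) - (a + b - 2 x) w(x)\<close>, integration by parts takes the form
  \<open>Z'(x) = (x - a) (b - x) w''(x) + 2 w(x)\<close>, and \<open>Z\<close> vanishes at both end points. Hence the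
  integral of \<open>w\<close> is that of \<open>w''\<close> against the Peano kernel \<open>- (x - a) (b - x) / 2\<close>, which has
  constant sign.\<close>

lemma trapezoidal_bound:
  fixes w :: "real \<Rightarrow> real"
  assumes ab: "a \<le> b" and w: "C_on 2 w {a..b}" and w0: "w a = 0" "w b = 0"
    and M: "\<And>x. x \<in> {a..b} \<Longrightarrow> \<bar>(deriv ^^ 2) w x\<bar> \<le> M"
  shows "\<bar>integral {a..b} w\<bar> \<le> (b - a) ^ 3 / 12 * M"
proof -
  define Z where "Z = (\<lambda>x. (x - a) * (b - x) * deriv w x - (a + b - 2 * x) * w x)"
  \<comment> \<open>an antiderivative of \<open>(x - a) (b - x)\<close>\<close>
  define K where "K = (\<lambda>x. (x - a)\<^sup>2 * (b - a) / 2 - (x - a) ^ 3 / 3)"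
  have "(w has_integral integral {a..b} w) {a..b}"
    using C_on_continuous_on[OF w, of 0] by (intro integrable_integral integrable_continuous_real) simp
  from has_integral_mult_right[OF this, of 2]
  have I: "((\<lambda>x. 2 * w x) has_integral 2 * integral {a..b} w) {a..b}" .
  have "(Z has_real_derivative (x - a) * (b - x) * (deriv ^^ 2) w x + 2 * w x) (at x)"
    if "x \<in> {a..b}" for x
  proof -
    have w': "(w has_real_derivative deriv w x) (at x)"
      "(deriv w has_real_derivative (deriv ^^ 2) w x) (at x)"
      using C_on_DERIV_low(1,2)[OF w that] by simp_all
    show ?thesis
      unfolding Z_def by (rule w' derivative_eq_intros refl)+ algebra
  qed
  then have "((\<lambda>x. (x - a) * (b - x) * (deriv ^^ 2) w x + 2 * w x) has_integral Z b - Z a) {a..b}"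
    by (intro has_integral_DERIV[OF ab])
  moreover have "Z b - Z a = 0"
    by (simp add: Z_def w0)
  ultimately have J: "((\<lambda>x. (x - a) * (b - x) * (deriv ^^ 2) w x) has_integral - (2 * integral {a..b} w)) {a..b}"
    using has_integral_diff[OF _ I] by fastforce
  have "(K has_real_derivative (x - a) * (b - x)) (at x)" for x
    unfolding K_def
    by (auto intro!: derivative_eq_intros simp: power2_eq_square field_simps)
  then have "((\<lambda>x. (x - a) * (b - x)) has_integral K b - K a) {a..b}"
    by (intro has_integral_DERIV[OF ab])
  moreover have "K b - K a = (b - a) ^ 3 / 6"
    by (simp add: K_def power2_eq_square power3_eq_cube field_simps)
  ultimately have U: "((\<lambda>x. M * ((x - a) * (b - x))) has_integral M * ((b - a) ^ 3 / 6)) {a..b}"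
    using has_integral_mult_right by metis
  have le: "\<bar>(x - a) * (b - x) * (deriv ^^ 2) w x\<bar> \<le> M * ((x - a) * (b - x))" if "x \<in> {a..b}" for x
    using mult_left_mono[OF M[OF that], of "(x - a) * (b - x)"] that
    by (simp add: abs_mult mult_ac)
  have "- (2 * integral {a..b} w) \<le> M * ((b - a) ^ 3 / 6)"
    using le by (intro has_integral_le[OF J U]) (simp add: abs_le_iff)
  moreover have "- (- (2 * integral {a..b} w)) \<le> M * ((b - a) ^ 3 / 6)"
    using le by (intro has_integral_le[OF has_integral_neg[OF J] U]) (simp add: abs_le_iff)
  moreover have "M * ((b - a) ^ 3 / 6) = 2 * ((b - a) ^ 3 / 12 * M)"
    by simp
  ultimately show ?thesis
    by linarith
qed

lemma C_on_diff:
  assumes f: "C_on k f UNIV" and g: "C_on k g UNIV"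
  shows "C_on k (\<lambda>x. f x - g x) UNIV"
    and "i \<le> k \<Longrightarrow> (deriv ^^ i) (\<lambda>x. f x - g x) = (\<lambda>x. (deriv ^^ i) f x - (deriv ^^ i) g x)"
proof -
  let ?D = "\<lambda>i x. (deriv ^^ i) f x - (deriv ^^ i) g x"
  have D: "(?D i has_real_derivative ?D (Suc i) x) (at x)" if "i < k" for i x
    by (intro DERIV_diff C_on_DERIV[OF f that] C_on_DERIV[OF g that]) simp_all
  show "C_on k (\<lambda>x. f x - g x) UNIV"
    by (rule C_on_UNIV_I[where D = ?D])
      (use C_on_continuous_on[OF f] C_on_continuous_on[OF g] D in \<open>auto intro!: continuous_intros\<close>)
  show "(deriv ^^ i) (\<lambda>x. f x - g x) = ?D i" if "i \<le> k"
    by (rule iterated_deriv_eqI[where D = ?D, OF _ D that]) simp_all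
qed

text \<open>The reparametrisation of \<open>fs\<close> that takes the same values as \<open>f\<close> at the two nodes; it takes
  the part of the linear interpolant in the classical trapezoidal rule.\<close>

definition affine_interpolant :: "(real \<Rightarrow> real) \<Rightarrow> real \<Rightarrow> real \<Rightarrow> (real \<Rightarrow> real) \<Rightarrow> real \<Rightarrow> real" where
  "affine_interpolant fs a h f = affine_comp fs (alpha_f fs a h f) (beta_f fs a h f)"

lemma affine_interpolant_interpolates:
  assumes "h > 0" "range f \<subseteq> range fs"
  shows "affine_interpolant fs a h f a = f a" "affine_interpolant fs a h f (a + h) = f (a + h)"
proof -
  have "alpha_f fs a h f * a + beta_f fs a h f = inv fs (f a)"
    "alpha_f fs a h f * (a + h) + beta_f fs a h f = inv fs (f (a + h))"
    using assms(1) by (simp_all add: alpha_f_def beta_f_def field_simps)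
  then show "affine_interpolant fs a h f a = f a" "affine_interpolant fs a h f (a + h) = f (a + h)"
    using assms(2) by (simp_all add: affine_interpolant_def affine_comp_def f_inv_into_f range_subsetD)
qed

text \<open>The quadrature formula sees only the nodal values, so it cannot distinguish \<open>f\<close> from its
  interpolant, on which it is exact. The error is thus an integral of a function that vanishes at
  both end points.\<close>

lemma quad_error_eq_integral:
  assumes h: "h > 0" and exact: "affinely_exact q a fs" and fs: "C_on 2 fs UNIV"
    and f: "C_on 2 f UNIV" and r: "range f \<subseteq> range fs"
  shows "quad q a h f - exact_int a h f = - integral {a..a + h} (\<lambda>x. f x - affine_interpolant fs a h f x)"
proof -
  let ?g = "affine_interpolant fs a h f"
  have "?g a = f a" "?g (a + h) = f (a + h)"
    by (rule affine_interpolant_interpolates[OF h r])+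
  then have "quad q a h f = quad q a h ?g"
    by (simp add: quad_def)
  also have "\<dots> = integral {a..a + h} ?g"
    using exact h by (simp add: affinely_exact_def affine_interpolant_def exact_int_def)
  finally have "quad q a h f - exact_int a h f = integral {a..a + h} ?g - integral {a..a + h} f"
    by (simp add: exact_int_def)
  moreover have "f integrable_on {a..a + h}" "?g integrable_on {a..a + h}"
    unfolding affine_interpolant_def
    by (intro integrable_continuous_real C_on_imp_continuous_on[OF f]
        C_on_imp_continuous_on[OF C_on_affine_comp[OF fs]])+
  ultimately show ?thesis
    by (simp add: Henstock_Kurzweil_Integration.integral_diff)
qed

lemma quad_error_le_second_deriv:
  assumes h: "h > 0" and exact: "affinely_exact q a fs" and fs: "C_on 2 fs UNIV"
    and f: "C_on 2 f UNIV" and r: "range f \<subseteq> range fs"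
  shows "\<bar>quad q a h f - exact_int a h f\<bar>
     \<le> h ^ 3 / 12 * (SUP \<xi>\<in>{a..a + h}.
          \<bar>(deriv ^^ 2) f \<xi> - (alpha_f fs a h f)\<^sup>2
              * (deriv ^^ 2) fs (alpha_f fs a h f * \<xi> + beta_f fs a h f)\<bar>)"
proof -
  let ?g = "affine_interpolant fs a h f"
  let ?w = "\<lambda>x. f x - ?g x"
  have g: "C_on 2 ?g UNIV"
    unfolding affine_interpolant_def by (rule C_on_affine_comp[OF fs])
  have w2: "(deriv ^^ 2) ?w = (\<lambda>\<xi>. (deriv ^^ 2) f \<xi> - (alpha_f fs a h f)\<^sup>2
              * (deriv ^^ 2) fs (alpha_f fs a h f * \<xi> + beta_f fs a h f))"
    using C_on_diff(2)[OF f g order_refl] iterated_deriv_affine_comp[OF fs order_refl]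
    by (simp add: affine_interpolant_def)
  have w: "C_on 2 ?w X" for X
    using C_on_diff(1)[OF f g] unfolding C_on_def by blast
  have "\<bar>integral {a..a + h} ?w\<bar> \<le> (a + h - a) ^ 3 / 12 * (SUP \<xi>\<in>{a..a + h}. \<bar>(deriv ^^ 2) ?w \<xi>\<bar>)"
  proof (rule trapezoidal_bound)
    show "\<bar>(deriv ^^ 2) ?w x\<bar> \<le> (SUP \<xi>\<in>{a..a + h}. \<bar>(deriv ^^ 2) ?w \<xi>\<bar>)"
      if "x \<in> {a..a + h}" for x
      by (rule abs_le_SUP_of_continuous[OF C_on_continuous_on[OF w order_refl] that])
  qed (use h affine_interpolant_interpolates[OF h r] w in auto)
  then show ?thesis
    unfolding quad_error_eq_integral[OF assms] w2 by simp
qed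

section \<open>The Sturm-Liouville bound\<close>

text \<open>The operator in divergence form is only available through the flux \<open>p u'\<close>: the first equation is
  what uniqueness and the Green function need, the second one expands the operator in order to
  obtain continuity and the behaviour under affine substitutions.\<close>

lemma SL_affine_flux_DERIV:
  assumes p: "C_on 1 p UNIV" and u: "C_on 2 u X" and x: "x \<in> X"
  shows "((\<lambda>t. p (\<alpha> * t + \<beta>) * deriv u t) has_real_derivative
          \<alpha>\<^sup>2 * s (\<alpha> * x + \<beta>) * u x - SL_affine p s \<alpha> \<beta> u x) (at x)"
    and "SL_affine p s \<alpha> \<beta> u x = - (\<alpha> * deriv p (\<alpha> * x + \<beta>) * deriv u x
           + p (\<alpha> * x + \<beta>) * (deriv ^^ 2) u x) + \<alpha>\<^sup>2 * s (\<alpha> * x + \<beta>) * u x"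
proof -
  have "((\<lambda>t. p (\<alpha> * t + \<beta>)) has_real_derivative deriv p (\<alpha> * x + \<beta>) * \<alpha>) (at x)"
    by (rule DERIV_chain2[OF C_on_DERIV_low(1)[OF p UNIV_I]]) (auto intro!: derivative_eq_intros)
  from DERIV_mult[OF this C_on_DERIV_low(2)[OF u x]]
  have D: "((\<lambda>t. p (\<alpha> * t + \<beta>) * deriv u t) has_real_derivative
     \<alpha> * deriv p (\<alpha> * x + \<beta>) * deriv u x + p (\<alpha> * x + \<beta>) * (deriv ^^ 2) u x) (at x)"
    by (simp add: algebra_simps)
  show eq: "SL_affine p s \<alpha> \<beta> u x = - (\<alpha> * deriv p (\<alpha> * x + \<beta>) * deriv u x
           + p (\<alpha> * x + \<beta>) * (deriv ^^ 2) u x) + \<alpha>\<^sup>2 * s (\<alpha> * x + \<beta>) * u x"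
    using DERIV_imp_deriv[OF D] by (simp add: SL_affine_def)
  show "((\<lambda>t. p (\<alpha> * t + \<beta>) * deriv u t) has_real_derivative
          \<alpha>\<^sup>2 * s (\<alpha> * x + \<beta>) * u x - SL_affine p s \<alpha> \<beta> u x) (at x)"
    using D unfolding eq by simp
qed

lemma SL_affine_continuous_on:
  assumes p: "C_on 1 p UNIV" and s: "continuous_on UNIV s" and f: "C_on 2 f UNIV"
  shows "continuous_on X (SL_affine p s \<alpha> \<beta> f)"
proof -
  have "continuous_on UNIV p" "continuous_on UNIV (deriv p)"
    using C_on_imp_continuous_on[OF p] C_on_continuous_on[OF p order_refl] by simp_all
  note c = this[THEN continuous_on_affine_compose, of X \<alpha> \<beta>] continuous_on_affine_compose[OF s, of X \<alpha> \<beta>]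
  have d: "continuous_on X f" "continuous_on X (deriv f)" "continuous_on X ((deriv ^^ 2) f)"
    using C_on_imp_continuous_on[OF f] C_on_continuous_on[OF f, of 1]
      C_on_continuous_on[OF f order_refl] by (auto intro: continuous_on_subset)
  have "SL_affine p s \<alpha> \<beta> f = (\<lambda>x. - (\<alpha> * deriv p (\<alpha> * x + \<beta>) * deriv f x
           + p (\<alpha> * x + \<beta>) * (deriv ^^ 2) f x) + \<alpha>\<^sup>2 * s (\<alpha> * x + \<beta>) * f x)"
    using SL_affine_flux_DERIV(2)[OF p f UNIV_I] by blast
  then show ?thesis
    using c d by (auto intro!: continuous_intros)
qed

lemma SL_affine_affine_comp:
  assumes p: "C_on 1 p UNIV" and g: "C_on 2 g UNIV"
  shows "SL_affine p s \<alpha> \<beta> (affine_comp g \<alpha> \<beta>) x = \<alpha>\<^sup>2 * SL p s g (\<alpha> * x + \<beta>)"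
proof -
  let ?y = "\<alpha> * x + \<beta>" and ?u = "affine_comp g \<alpha> \<beta>"
  have "SL p s g ?y = SL_affine p s 1 0 g ?y"
    by (simp add: SL_def SL_affine_def)
  then have SL: "SL p s g ?y = - (deriv p ?y * deriv g ?y + p ?y * (deriv ^^ 2) g ?y) + s ?y * g ?y"
    using SL_affine_flux_DERIV(2)[OF p g UNIV_I, of s 1 0 ?y] by simp
  have u: "?u x = g ?y" "deriv ?u x = \<alpha> * deriv g ?y" "(deriv ^^ 2) ?u x = \<alpha>\<^sup>2 * (deriv ^^ 2) g ?y"
    using fun_cong[OF iterated_deriv_affine_comp[OF g, of 1 \<alpha> \<beta>], of x]
      fun_cong[OF iterated_deriv_affine_comp[OF g, of 2 \<alpha> \<beta>], of x]
    by (simp_all add: affine_comp_def[of g \<alpha> \<beta>, THEN fun_cong])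
  show ?thesis
    unfolding SL SL_affine_flux_DERIV(2)[OF p C_on_affine_comp[OF g] UNIV_I] u by algebra
qed

text \<open>Only the derivative has to extend continuously to the end points: by the mean value theorem
  \<open>F\<close> differs from its value at the midpoint by a bounded amount.\<close>

lemma bounded_if_bounded_DERIV:
  fixes F :: "real \<Rightarrow> real"
  assumes "\<And>x. x \<in> {a<..<b} \<Longrightarrow> (F has_real_derivative F' x) (at x)"
    and "continuous_on {a..b} F'"
  obtains K where "\<And>x. x \<in> {a<..<b} \<Longrightarrow> \<bar>F x\<bar> \<le> K"
proof -
  let ?B = "SUP \<xi>\<in>{a..b}. \<bar>F' \<xi>\<bar>" and ?c = "(a + b) / 2"
  have "\<bar>F x\<bar> \<le> \<bar>F ?c\<bar> + ?B * (b - a)" if x: "x \<in> {a<..<b}" for x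
  proof -
    have B: "\<bar>F' y\<bar> \<le> ?B" if "y \<in> {a<..<b}" for y
      using abs_le_SUP_of_continuous[OF assms(2)] that by simp
    have "norm (F x - F ?c) \<le> ?B * norm (x - ?c)"
      by (rule field_differentiable_bound[of "{a<..<b}" F F'])
        (use assms(1) B x in \<open>auto intro: has_field_derivative_at_within\<close>)
    also have "\<dots> \<le> ?B * (b - a)"
      using B[OF x] x by (intro mult_left_mono) (auto simp: abs_le_iff field_simps)
    finally show ?thesis by simp
  qed
  then show thesis by (rule that)
qed

text \<open>Solvability with right-hand side \<open>v\<close> forces a homogeneous solution \<open>v\<close> to vanish, by
  self-adjointness: \<open>\<integral> v\<^sup>2 = \<integral> v D u = \<integral> u D v = 0\<close> if \<open>D u = v\<close> and \<open>D v = 0\<close>. In pointwise form,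
  the Wronskian \<open>W = P (v u' - u v')\<close> has the derivative \<open>- v\<^sup>2\<close>. The derivatives \<open>u'\<close> and \<open>v'\<close> are
  controlled only inside the interval, but the equations bound the derivatives of the fluxes
  \<open>P u'\<close> and \<open>P v'\<close> and hence the fluxes themselves; since \<open>u\<close> and \<open>v\<close> tend to \<open>0\<close> at the end
  points, so does \<open>W\<close>.\<close>

lemma dirichlet_uniqueness:
  fixes P S u u' v v' :: "real \<Rightarrow> real"
  assumes ab: "a < b" and S: "continuous_on {a..b} S"
    and cont: "continuous_on {a..b} u" "continuous_on {a..b} v"
    and bd: "u a = 0" "u b = 0" "v a = 0" "v b = 0"
    and u: "\<And>x. x \<in> {a<..<b} \<Longrightarrow> (u has_real_derivative u' x) (at x)"
    and v: "\<And>x. x \<in> {a<..<b} \<Longrightarrow> (v has_real_derivative v' x) (at x)"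
    and Pu: "\<And>x. x \<in> {a<..<b} \<Longrightarrow>
               ((\<lambda>t. P t * u' t) has_real_derivative S x * u x - v x) (at x)"
    and Pv: "\<And>x. x \<in> {a<..<b} \<Longrightarrow> ((\<lambda>t. P t * v' t) has_real_derivative S x * v x) (at x)"
    and x: "x \<in> {a..b}"
  shows "v x = 0"
proof -
  have "continuous_on {a..b} (\<lambda>x. S x * u x - v x)" "continuous_on {a..b} (\<lambda>x. S x * v x)"
    by (intro continuous_intros S cont)+
  then obtain K1 K2 where K1: "\<And>x. x \<in> {a<..<b} \<Longrightarrow> \<bar>P x * u' x\<bar> \<le> K1"
    and K2: "\<And>x. x \<in> {a<..<b} \<Longrightarrow> \<bar>P x * v' x\<bar> \<le> K2"
    using bounded_if_bounded_DERIV[OF Pu] bounded_if_bounded_DERIV[OF Pv] by metis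
  \<comment> \<open>The Wronskian, extended by its limits to the end points.\<close>
  define W where
    "W x = (if x \<in> {a<..<b} then v x * (P x * u' x) - u x * (P x * v' x) else 0)" for x
  have W_DERIV: "(W has_real_derivative - (v x)\<^sup>2) (at x)" if "x \<in> {a<..<b}" for x
  proof -
    have "((\<lambda>x. v x * (P x * u' x) - u x * (P x * v' x)) has_real_derivative - (v x)\<^sup>2) (at x)"
      by (rule DERIV_cong[OF DERIV_diff[OF DERIV_mult[OF v[OF that] Pu[OF that]]
              DERIV_mult[OF u[OF that] Pv[OF that]]]]) algebra
    then show ?thesis
      by (rule has_field_derivative_transform_within_open[of _ _ _ "{a<..<b}"])
        (use that in \<open>auto simp: W_def\<close>)
  qed
  have W_le: "\<bar>W x\<bar> \<le> \<bar>v x\<bar> * K1 + \<bar>u x\<bar> * K2" if "x \<in> {a..b}" for x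
  proof (cases "x \<in> {a<..<b}")
    case True
    then have "\<bar>W x\<bar> \<le> \<bar>v x\<bar> * \<bar>P x * u' x\<bar> + \<bar>u x\<bar> * \<bar>P x * v' x\<bar>"
      by (simp add: W_def abs_mult[symmetric])
    also have "\<dots> \<le> \<bar>v x\<bar> * K1 + \<bar>u x\<bar> * K2"
      by (intro add_mono mult_left_mono K1[OF True] K2[OF True]) auto
    finally show ?thesis .
  next
    case False
    then have "x = a \<or> x = b" using that by auto
    then show ?thesis using bd by (auto simp: W_def)
  qed
  have "continuous_on {a..b} W"
    unfolding continuous_on_eq_continuous_within
  proof
    fix x assume x: "x \<in> {a..b}"
    show "continuous (at x within {a..b}) W"
    proof (cases "x \<in> {a<..<b}")
      case True
      then show ?thesis
        using W_DERIV DERIV_isCont continuous_at_imp_continuous_at_within by blast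
    next
      case False
      then have xe: "x = a \<or> x = b" using x by auto
      have "continuous (at x within {a..b}) (\<lambda>x. \<bar>v x\<bar> * K1 + \<bar>u x\<bar> * K2)"
        using cont x by (intro continuous_intros) (simp_all add: continuous_on_eq_continuous_within)
      then have "((\<lambda>x. \<bar>v x\<bar> * K1 + \<bar>u x\<bar> * K2) \<longlongrightarrow> 0) (at x within {a..b})"
        using xe bd by (auto simp: continuous_within)
      then have "(W \<longlongrightarrow> 0) (at x within {a..b})"
        by (rule Lim_null_comparison[rotated]) (use W_le in \<open>auto simp: eventually_at_filter\<close>)
      moreover have "W x = 0"
        using xe by (auto simp: W_def)
      ultimately show ?thesis
        by (simp add: continuous_within)
    qed
  qed
  then have "((\<lambda>x. - (v x)\<^sup>2) has_integral W b - W a) {a..b}"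
    using ab W_DERIV by (intro fundamental_theorem_of_calculus_interior)
      (auto simp: has_real_derivative_iff_has_vector_derivative)
  from has_integral_neg[OF this] have "integral {a..b} (\<lambda>x. (v x)\<^sup>2) = 0"
    by (simp add: W_def integral_unique)
  moreover have "continuous_on {a..b} (\<lambda>x. (v x)\<^sup>2)"
    by (intro continuous_intros cont)
  ultimately show ?thesis
    using integral_eq_0_iff[of a b "\<lambda>x. (v x)\<^sup>2"] ab x by simp
qed

text \<open>The kernel yields some solution \<open>u\<close> of the Dirichlet problem for the right-hand side
  \<open>D f = D (f - g)\<close>. That it is \<open>f - g\<close> itself is a matter of uniqueness, and uniqueness follows
  from the existence of the Green function: applied to \<open>v = f - g - u\<close> the kernel provides the
  partner \<open>z\<close> with \<open>D z = v\<close> that \<open>dirichlet_uniqueness\<close> asks for.\<close>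

lemma green_function_represents:
  assumes ab: "a < b" and p: "C_on 1 p UNIV" and s: "continuous_on UNIV s"
    and G: "green_function (SL_affine p s \<alpha> \<beta>) a b G"
    and f: "C_on 2 f UNIV" and g: "C_on 2 g UNIV" and g0: "\<And>x. SL_affine p s \<alpha> \<beta> g x = 0"
    and bd: "f a = g a" "f b = g b" and x: "x \<in> {a..b}"
  shows "f x - g x = integral {a..b} (\<lambda>y. G x y * SL_affine p s \<alpha> \<beta> f y)"
proof -
  let ?D = "SL_affine p s \<alpha> \<beta>" and ?P = "\<lambda>t. p (\<alpha> * t + \<beta>)" and ?S = "\<lambda>x. \<alpha>\<^sup>2 * s (\<alpha> * x + \<beta>)"
  define u where "u x = integral {a..b} (\<lambda>y. G x y * ?D f y)" for x
  have "dirichlet_solution ?D a b (?D f) u"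
    using G SL_affine_continuous_on[OF p s f] unfolding green_function_def u_def by blast
  then have u: "continuous_on {a..b} u" "C_on 2 u {a<..<b}" "u a = 0" "u b = 0"
    and Du: "\<And>x. x \<in> {a<..<b} \<Longrightarrow> ?D u x = ?D f x"
    by (auto simp: dirichlet_solution_def)
  define v where "v x = f x - g x - u x" for x
  have vc: "continuous_on {a..b} v"
    unfolding v_def
    by (intro continuous_on_diff u(1) C_on_imp_continuous_on[OF f] C_on_imp_continuous_on[OF g])
  define z where "z x = integral {a..b} (\<lambda>y. G x y * v y)" for x
  have "dirichlet_solution ?D a b v z"
    using G vc unfolding green_function_def z_def by blast
  then have z: "continuous_on {a..b} z" "C_on 2 z {a<..<b}" "z a = 0" "z b = 0"
    and Dz: "\<And>x. x \<in> {a<..<b} \<Longrightarrow> ?D z x = v x"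
    by (auto simp: dirichlet_solution_def)
  have "v x = 0"
  proof (rule dirichlet_uniqueness[OF ab _ z(1) vc z(3,4), where S = ?S and P = ?P
        and u' = "deriv z" and v' = "\<lambda>t. deriv f t - deriv g t - deriv u t"])
    show "continuous_on {a..b} ?S"
      by (intro continuous_intros continuous_on_affine_compose s)
    show "v a = 0" "v b = 0"
      by (simp_all add: v_def bd u)
    show "(z has_real_derivative deriv z t) (at t)" if "t \<in> {a<..<b}" for t
      using C_on_DERIV_low(1)[OF z(2) that] by simp
    show "(v has_real_derivative deriv f t - deriv g t - deriv u t) (at t)" if "t \<in> {a<..<b}" for t
      unfolding v_def[abs_def]
      using C_on_DERIV_low(1)[OF u(2) that] C_on_DERIV_low(1)[OF f UNIV_I]
        C_on_DERIV_low(1)[OF g UNIV_I] by (intro DERIV_diff) simp_all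
    show "((\<lambda>t. ?P t * deriv z t) has_real_derivative ?S t * z t - v t) (at t)"
      if "t \<in> {a<..<b}" for t
      using SL_affine_flux_DERIV(1)[OF p z(2) that, of \<alpha> \<beta> s] Dz[OF that] by simp
    show "((\<lambda>t. ?P t * (deriv f t - deriv g t - deriv u t)) has_real_derivative ?S t * v t) (at t)"
      if "t \<in> {a<..<b}" for t
    proof -
      have "((\<lambda>t. ?P t * deriv f t - ?P t * deriv g t - ?P t * deriv u t) has_real_derivative
          (?S t * f t - ?D f t) - (?S t * g t - ?D g t) - (?S t * u t - ?D u t)) (at t)"
        by (intro DERIV_diff SL_affine_flux_DERIV(1)[OF p f UNIV_I]
            SL_affine_flux_DERIV(1)[OF p g UNIV_I] SL_affine_flux_DERIV(1)[OF p u(2) that])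
      then show ?thesis
        by (simp add: g0 Du[OF that] v_def algebra_simps)
    qed
  qed (rule x)
  then show ?thesis by (simp add: v_def u_def)
qed

text \<open>The estimate integrates the kernel in \<open>y\<close> before \<open>x\<close>, whereas the constant is stated with the
  other order; continuity of the kernel permits the exchange.\<close>

lemma integral_kernel_bound:
  fixes G :: "real \<Rightarrow> real \<Rightarrow> real"
  assumes ab: "a \<le> b" and G: "continuous_on ({a..b} \<times> {a..b}) (\<lambda>(x, y). G x y)"
    and r: "continuous_on {a..b} r" and w: "continuous_on {a..b} w"
    and eq: "\<And>x. x \<in> {a..b} \<Longrightarrow> w x = integral {a..b} (\<lambda>y. G x y * r y)"
  shows "\<bar>integral {a..b} w\<bar>
    \<le> integral {a..b} (\<lambda>y. integral {a..b} (\<lambda>x. \<bar>G x y\<bar>)) * (SUP \<xi>\<in>{a..b}. \<bar>r \<xi>\<bar>)"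
proof -
  let ?M = "SUP \<xi>\<in>{a..b}. \<bar>r \<xi>\<bar>"
  have absG: "continuous_on ({a..b} \<times> {a..b}) (\<lambda>(x, y). \<bar>G x y\<bar>)"
    using continuous_on_rabs[OF G] by (simp add: case_prod_unfold)
  have Gx: "continuous_on {a..b} (G x)" if "x \<in> {a..b}" for x
  proof -
    have "continuous_on {a..b} (\<lambda>y. (x, y))" by (intro continuous_intros)
    moreover have "(\<lambda>y. (x, y)) ` {a..b} \<subseteq> {a..b} \<times> {a..b}" using that by auto
    ultimately show ?thesis using continuous_on_compose2[OF G] by force
  qed
  have w_le: "norm (w x) \<le> ?M * integral {a..b} (\<lambda>y. \<bar>G x y\<bar>)" if x: "x \<in> {a..b}" for x
  proof -
    have "norm (w x) \<le> integral {a..b} (\<lambda>y. ?M * \<bar>G x y\<bar>)"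
      unfolding eq[OF x]
    proof (rule Henstock_Kurzweil_Integration.integral_norm_bound_integral)
      fix y assume "y \<in> {a..b}"
      then show "norm (G x y * r y) \<le> ?M * \<bar>G x y\<bar>"
        using mult_left_mono[OF abs_le_SUP_of_continuous[OF r], of y "\<bar>G x y\<bar>"]
        by (simp add: abs_mult mult_ac)
    qed (auto intro!: integrable_continuous_real continuous_intros Gx x r)
    then show ?thesis by simp
  qed
  have "continuous_on {a..b} (\<lambda>x. integral (cbox a b) (\<lambda>y. \<bar>G x y\<bar>))"
    by (rule integral_continuous_on_param) (use absG in simp)
  then have "norm (integral {a..b} w) \<le> integral {a..b} (\<lambda>x. ?M * integral {a..b} (\<lambda>y. \<bar>G x y\<bar>))"
    using w w_le
    by (intro Henstock_Kurzweil_Integration.integral_norm_bound_integral)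
      (auto intro!: integrable_continuous_real continuous_intros)
  also have "\<dots> = ?M * integral {a..b} (\<lambda>x. integral {a..b} (\<lambda>y. \<bar>G x y\<bar>))"
    by simp
  also have "integral {a..b} (\<lambda>x. integral {a..b} (\<lambda>y. \<bar>G x y\<bar>))
      = integral {a..b} (\<lambda>y. integral {a..b} (\<lambda>x. \<bar>G x y\<bar>))"
    using integral_swap_continuous[of a a b b "\<lambda>x y. \<bar>G x y\<bar>"] absG
    by (simp add: cbox_Pair_eq)
  finally show ?thesis by (simp add: mult.commute)
qed

text \<open>The interpolant \<open>g\<close> is annihilated by the substituted operator because \<open>fs\<close> is annihilated by
  the original one, so \<open>f - g\<close> is the image of \<open>L f\<close> under the Green function.\<close>

lemma quad_error_le_SL:
  assumes h: "h > 0" and exact: "affinely_exact q a fs" and fs: "C_on 2 fs UNIV"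
    and p: "C_on 1 p UNIV" and s: "continuous_on UNIV s" and SL: "\<And>x. SL p s fs x = 0"
    and f: "C_on 2 f UNIV" and r: "range f \<subseteq> range fs"
    and G: "green_function (SL_affine p s (alpha_f fs a h f) (beta_f fs a h f)) a (a + h) G"
  shows "\<bar>quad q a h f - exact_int a h f\<bar>
     \<le> integral {a..a + h} (\<lambda>y. integral {a..a + h} (\<lambda>x. \<bar>G x y\<bar>))
        * (SUP \<xi>\<in>{a..a + h}. \<bar>SL_affine p s (alpha_f fs a h f) (beta_f fs a h f) f \<xi>\<bar>)"
proof -
  let ?g = "affine_interpolant fs a h f"
  have g: "C_on 2 ?g UNIV"
    unfolding affine_interpolant_def by (rule C_on_affine_comp[OF fs])
  have "SL_affine p s (alpha_f fs a h f) (beta_f fs a h f) ?g x = 0" for x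
    by (simp add: affine_interpolant_def SL_affine_affine_comp[OF p fs] SL)
  then have "f x - ?g x = integral {a..a + h}
      (\<lambda>y. G x y * SL_affine p s (alpha_f fs a h f) (beta_f fs a h f) f y)"
    if "x \<in> {a..a + h}" for x
    using h affine_interpolant_interpolates[OF h r] that
    by (intro green_function_represents[OF _ p s G f g]) auto
  moreover have "continuous_on {a..a + h} (\<lambda>x. f x - ?g x)"
    by (rule C_on_imp_continuous_on[OF C_on_diff(1)[OF f g]])
  ultimately show ?thesis
    unfolding quad_error_eq_integral[OF h exact fs f r] abs_minus_cancel
    using h G SL_affine_continuous_on[OF p s f]
    by (intro integral_kernel_bound) (auto simp: green_function_def)
qed

section \<open>Error bounds for affinely exact two-point formulas\<close>

theorem theorem1:
  fixes q :: "real \<Rightarrow> real \<Rightarrow> real" and fs :: "real \<Rightarrow> real" and a h :: real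
  assumes h_pos: "h > 0"
    and exact: "affinely_exact q a fs"
  shows
    "(C_on 3 fs UNIV \<and> (\<forall>x. fs x \<noteq> 0) \<and> (\<forall>x. deriv fs x \<noteq> 0) \<and>
      (\<forall>c\<in>range fs. C_on 3 (q c) (range fs)) \<longrightarrow>
        (\<forall>f\<in>admissible q fs a h.
           \<bar>quad q a h f - exact_int a h f\<bar>
             \<le> h ^ 3 / 6 * (SUP \<xi>\<in>{a..a + h}. \<bar>err_op q a f \<xi>\<bar>)) \<and>
        nonlinear_on (admissible q fs a h) {a..a + h} (err_op q a) \<and>
        (\<forall>\<alpha> \<beta> \<xi>. err_op q a (affine_comp fs \<alpha> \<beta>) \<xi> = 0))
   \<and> (\<forall>R. C_on 2 fs UNIV \<and> bij_betw fs UNIV R \<longrightarrow>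
        (\<forall>f. C_on 2 f UNIV \<and> range f \<subseteq> R \<longrightarrow>
           \<bar>quad q a h f - exact_int a h f\<bar>
             \<le> h ^ 3 / 12 * (SUP \<xi>\<in>{a..a + h}.
                  \<bar>(deriv ^^ 2) f \<xi> - (alpha_f fs a h f)\<^sup>2
                      * (deriv ^^ 2) fs (alpha_f fs a h f * \<xi> + beta_f fs a h f)\<bar>)))
   \<and> (\<forall>R p s. C_on 2 fs UNIV \<and> bij_betw fs UNIV R \<and>
        C_on 1 p UNIV \<and> continuous_on UNIV s \<and>
        (\<forall>x\<in>{a..a + h}. p x > 0 \<and> s x > 0) \<and> (\<forall>x. SL p s fs x = 0) \<longrightarrow>
        (\<forall>f G. C_on 2 f UNIV \<and> range f \<subseteq> R \<and>
           green_function (SL_affine p s (alpha_f fs a h f) (beta_f fs a h f)) a (a + h) G \<longrightarrow>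
           \<bar>quad q a h f - exact_int a h f\<bar>
             \<le> integral {a..a + h} (\<lambda>y. integral {a..a + h} (\<lambda>x. \<bar>G x y\<bar>))
                * (SUP \<xi>\<in>{a..a + h}.
                     \<bar>SL_affine p s (alpha_f fs a h f) (beta_f fs a h f) f \<xi>\<bar>)))"
proof (intro conjI allI impI ballI)
  assume A: "C_on 3 fs UNIV \<and> (\<forall>x. fs x \<noteq> 0) \<and> (\<forall>x. deriv fs x \<noteq> 0) \<and>
      (\<forall>c\<in>range fs. C_on 3 (q c) (range fs))"
  show "\<bar>quad q a h f - exact_int a h f\<bar>
      \<le> h ^ 3 / 6 * (SUP \<xi>\<in>{a..a + h}. \<bar>err_op q a f \<xi>\<bar>)" if "f \<in> admissible q fs a h" for f
    using A that by (intro quad_error_le_err_op[OF h_pos exact]) auto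
  show "nonlinear_on (admissible q fs a h) {a..a + h} (err_op q a)"
    using A by (intro nonlinear_err_op[OF h_pos exact]) auto
  show "err_op q a (affine_comp fs \<alpha> \<beta>) \<xi> = 0" for \<alpha> \<beta> \<xi>
    using A by (intro affinely_exact_err_op_eq_0[OF exact]) auto
next
  fix R f
  assume "C_on 2 fs UNIV \<and> bij_betw fs UNIV R" and "C_on 2 f UNIV \<and> range f \<subseteq> R"
  then show "\<bar>quad q a h f - exact_int a h f\<bar>
     \<le> h ^ 3 / 12 * (SUP \<xi>\<in>{a..a + h}.
          \<bar>(deriv ^^ 2) f \<xi> - (alpha_f fs a h f)\<^sup>2
              * (deriv ^^ 2) fs (alpha_f fs a h f * \<xi> + beta_f fs a h f)\<bar>)"
    by (intro quad_error_le_second_deriv[OF h_pos exact]) (auto simp: bij_betw_def)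
next
  fix R p s f G
  assume "C_on 2 fs UNIV \<and> bij_betw fs UNIV R \<and> C_on 1 p UNIV \<and> continuous_on UNIV s \<and>
      (\<forall>x\<in>{a..a + h}. p x > 0 \<and> s x > 0) \<and> (\<forall>x. SL p s fs x = 0)"
    and "C_on 2 f UNIV \<and> range f \<subseteq> R \<and>
      green_function (SL_affine p s (alpha_f fs a h f) (beta_f fs a h f)) a (a + h) G"
  then show "\<bar>quad q a h f - exact_int a h f\<bar>
     \<le> integral {a..a + h} (\<lambda>y. integral {a..a + h} (\<lambda>x. \<bar>G x y\<bar>))
        * (SUP \<xi>\<in>{a..a + h}. \<bar>SL_affine p s (alpha_f fs a h f) (beta_f fs a h f) f \<xi>\<bar>)"
    by (intro quad_error_le_SL[OF h_pos exact]) (auto simp: bij_betw_def)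
qed

end
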